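(* Let $\pi\in\mathfrak{B}_n$, with paths defined via the $r$-order $d$-types. In the grid $P_\pi$: (a) each $0_h^+$-path (resp. $1_h^+$-path) goes from the left boundary to the right boundary along horizontal grid lines, except that it takes a southeast (resp. northeast) step across a positive square when it encounters one; (b) each $0_v^+$-path (resp. $1_v^+$-path) goes from the top boundary to the bottom boundary along vertical grid lines, except that it takes a southeast (resp. southwest) step across a positive square when it encounters one; (c) each $0_h^-$-path (resp. $1_h^-$-path) goes from the left boundary to the right boundary along horizontal grid lines, except that it takes a southeast (resp. northeast) step across a negative square when it encounters one; (d) each $0_v^-$-path (resp. $1_v^-$-path) goes from the top boundary to the bottom boundary along vertical grid lines, except that it takes a southeast (resp. southwest) step across a negative square when it encounters one.
   Context: $\mathfrak{B}_n$ is the set of signed permutations $\pi=\pi_1\cdots\pi_n$ ($\pi_i\in\{\pm1,\dots,\pm n\}$, $|\pi_1|,\dots,|\pi_n|$ a permutation of $[n]$), $\pi_0=0$, inverse given by $\pi^{-1}_{|\pi_i|}=\operatorname{sgn}(\pi_i)\,i$. The $r$-order on $\mathbb{Z}$ is $-1<_r-2<_r-3<_r\cdots<_r0<_r1<_r2<_r\cdots$; $\operatorname{des}_B(\pi)=|\{i\in\{0,\dots,n-1\}:\pi_i>_r\pi_{i+1}\}|$, $\operatorname{ides}_B(\pi)=\operatorname{des}_B(\pi^{-1})$. The grid $P_\pi$ is an $n\times n$ array of squares (rows from top, columns from left); $\langle i,j\rangle$ is the square in row $i$, column $j$; $\langle i,|\pi_i|\rangle$ is a positive square if $\pi_i>0$,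 negative if $\pi_i<0$. Grid point $(i,j)$ ($1\le i,j\le n+1$) is the intersection of the $i$-th horizontal and $j$-th vertical grid lines. For $i,j\in[n+1]$, $\varphi_{(i,j)}(\pi)$ is the $\sigma\in\mathfrak{B}_{n+1}$ with $\sigma_i=j$, $\sigma_k=s(\pi_k)$ for $k<i$, $\sigma_k=s(\pi_{k-1})$ for $k>i$, where $s(x)=x$ if $|x|<j$, $s(x)=x+1$ if $x\ge j$, $s(x)=x-1$ if $x\le-j$; $\overline{\varphi}_{(i,j)}(\pi)$ is the same with $\sigma_i=-j$. $d^+(i,j)=(d_h^+(i,j),d_v^+(i,j))=\big(\operatorname{des}_B(\varphi_{(i,j)}(\pi))-\operatorname{des}_B(\pi),\ \operatorname{ides}_B(\varphi_{(i,j)}(\pi))-\operatorname{ides}_B(\pi)\big)$, and $d^-(i,j)=(d_h^-(i,j),d_v^-(i,j))$ is the same with $\overline{\varphi}_{(i,j)}$. Paths: for $p\in\{0,1\}$, the $p_h^+$-paths (resp. $p_h^-$-paths) are obtained by connecting grid points of $d_h^+$-type (resp. $d_h^-$-type) $p$ only along horizontal grid lines, and then connecting the resulting segments that do not span a full grid line by diagonal lines only if they touch the same filled square; the $q_v^\pm$-paths are obtained analogously using $d_v^\pm$-types and vertical grid lines. *)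

theory Defs
  imports Main
begin

section \<open>Signed permutations and type B descents\<close>

text \<open>A signed permutation of \<open>[n]\<close> is a function with value \<open>0\<close> outside \<open>{1..n}\<close>;
  in particular the convention \<open>\<pi>\<^sub>0 = 0\<close> is built in.\<close>

definition signed_perms :: "nat \<Rightarrow> (nat \<Rightarrow> int) set" where
  "signed_perms n =
     {\<pi>. bij_betw (\<lambda>i. nat \<bar>\<pi> i\<bar>) {1..n} {1..n} \<and> (\<forall>i. i \<notin> {1..n} \<longrightarrow> \<pi> i = 0)}"

definition signed_inv :: "nat \<Rightarrow> (nat \<Rightarrow> int) \<Rightarrow> nat \<Rightarrow> int" where
  "signed_inv n \<pi> k =
     (if k \<in> {1..n}
      then let i = the_inv_into {1..n} (\<lambda>i. nat \<bar>\<pi> i\<bar>) k in sgn (\<pi> i) * int i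
      else 0)"

definition r_less :: "int \<Rightarrow> int \<Rightarrow> bool"  (infix "<\<^sub>r" 50) where
  "x <\<^sub>r y \<longleftrightarrow> (if x < 0 \<and> y < 0 then y < x else x < y)"

definition des_B :: "nat \<Rightarrow> (nat \<Rightarrow> int) \<Rightarrow> nat" where
  "des_B n \<pi> = card {i \<in> {0..<n}. \<pi> (i + 1) <\<^sub>r \<pi> i}"

definition ides_B :: "nat \<Rightarrow> (nat \<Rightarrow> int) \<Rightarrow> nat" where
  "ides_B n \<pi> = des_B n (signed_inv n \<pi>)"


section \<open>Insertion and the d-types\<close>

definition shift :: "nat \<Rightarrow> int \<Rightarrow> int" where
  "shift j x = (if \<bar>x\<bar> < int j then x else if x \<ge> int j then x + 1 else x - 1)"

definition insert_entry :: "nat \<Rightarrow> nat \<Rightarrow> int \<Rightarrow> (nat \<Rightarrow> int) \<Rightarrow> nat \<Rightarrow> int" where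
  "insert_entry i j v \<pi> k =
     (if k < i then shift j (\<pi> k) else if k = i then v else shift j (\<pi> (k - 1)))"

type_synonym point = "nat \<times> nat"

fun phi :: "point \<Rightarrow> (nat \<Rightarrow> int) \<Rightarrow> nat \<Rightarrow> int" where
  "phi (i, j) \<pi> = insert_entry i j (int j) \<pi>"

fun phi_bar :: "point \<Rightarrow> (nat \<Rightarrow> int) \<Rightarrow> nat \<Rightarrow> int" where
  "phi_bar (i, j) \<pi> = insert_entry i j (- int j) \<pi>"

definition d_plus :: "nat \<Rightarrow> (nat \<Rightarrow> int) \<Rightarrow> point \<Rightarrow> int \<times> int" where
  "d_plus n \<pi> P =
     (int (des_B (n + 1) (phi P \<pi>)) - int (des_B n \<pi>),
      int (ides_B (n + 1) (phi P \<pi>)) - int (ides_B n \<pi>))"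

definition d_minus :: "nat \<Rightarrow> (nat \<Rightarrow> int) \<Rightarrow> point \<Rightarrow> int \<times> int" where
  "d_minus n \<pi> P =
     (int (des_B (n + 1) (phi_bar P \<pi>)) - int (des_B n \<pi>),
      int (ides_B (n + 1) (phi_bar P \<pi>)) - int (ides_B n \<pi>))"


section \<open>The grid\<close>

text \<open>Points are pairs (index of the horizontal line, index of the vertical line), counted from
  the top and from the left, so the first coordinate increases southwards. Squares are named by
  (row, column), that is, by their north-west corner.\<close>

type_synonym square = "nat \<times> nat"

definition grid_points :: "nat \<Rightarrow> point set" where
  "grid_points n = {1..n + 1} \<times> {1..n + 1}"

definition positive_squares :: "nat \<Rightarrow> (nat \<Rightarrow> int) \<Rightarrow> square set" where
  "positive_squares n \<pi> = {(i, nat \<bar>\<pi> i\<bar>) | i. i \<in> {1..n} \<and> \<pi> i > 0}"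

definition negative_squares :: "nat \<Rightarrow> (nat \<Rightarrow> int) \<Rightarrow> square set" where
  "negative_squares n \<pi> = {(i, nat \<bar>\<pi> i\<bar>) | i. i \<in> {1..n} \<and> \<pi> i < 0}"

definition filled_squares :: "nat \<Rightarrow> (nat \<Rightarrow> int) \<Rightarrow> square set" where
  "filled_squares n \<pi> = positive_squares n \<pi> \<union> negative_squares n \<pi>"

fun corners :: "square \<Rightarrow> point set" where
  "corners (a, b) = {(a, b), (a, b + 1), (a + 1, b), (a + 1, b + 1)}"

fun diagonals :: "square \<Rightarrow> point set set" where
  "diagonals (a, b) = {{(a, b), (a + 1, b + 1)}, {(a, b + 1), (a + 1, b)}}"

datatype orientation = Horizontal | Vertical

fun advance :: "orientation \<Rightarrow> point \<Rightarrow> point" where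
  "advance Horizontal (i, j) = (i, j + 1)"
| "advance Vertical (i, j) = (i + 1, j)"

fun grid_line :: "nat \<Rightarrow> orientation \<Rightarrow> nat \<Rightarrow> point set" where
  "grid_line n Horizontal k = {k} \<times> {1..n + 1}"
| "grid_line n Vertical k = {1..n + 1} \<times> {k}"


section \<open>Paths\<close>

definition components :: "'a set \<Rightarrow> 'a set set \<Rightarrow> 'a set set" where
  "components V E = {{y \<in> V. (x, y) \<in> {(u, v). {u, v} \<in> E}\<^sup>*} | x. x \<in> V}"

definition type_points :: "nat \<Rightarrow> (point \<Rightarrow> int) \<Rightarrow> int \<Rightarrow> point set" where
  "type_points n d p = {P \<in> grid_points n. d P = p}"

definition unit_lines :: "orientation \<Rightarrow> point set \<Rightarrow> point set set" where
  "unit_lines w T = {{P, advance w P} | P. P \<in> T \<and> advance w P \<in> T}"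

definition segments :: "orientation \<Rightarrow> point set \<Rightarrow> point set set" where
  "segments w T = components T (unit_lines w T)"

definition spans_line :: "nat \<Rightarrow> orientation \<Rightarrow> point set \<Rightarrow> bool" where
  "spans_line n w S \<longleftrightarrow> (\<exists>k. S = grid_line n w k)"

text \<open>A segment touches a square at a corner if that corner is all they have in common; a segment
  that runs along a whole side of the square does not touch it. This distinction matters: for
  \<open>\<pi> = 1, -2, 3\<close>, two horizontal segments of \<open>d\<^sub>h\<^sup>+\<close>-type \<open>0\<close> run along the upper and the lower
  side of the negative square in row 2, and they belong to different paths.\<close>

definition touches_at :: "point set \<Rightarrow> square \<Rightarrow> point \<Rightarrow> bool" where
  "touches_at S s P \<longleftrightarrow> S \<inter> corners s = {P}"

definition diagonal_lines ::
    "orientation \<Rightarrow> nat \<Rightarrow> (nat \<Rightarrow> int) \<Rightarrow> point set \<Rightarrow> point set set" where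
  "diagonal_lines w n \<pi> T =
     {{P, Q} | P Q. \<exists>s \<in> filled_squares n \<pi>. \<exists>S \<in> segments w T. \<exists>S' \<in> segments w T.
        \<not> spans_line n w S \<and> \<not> spans_line n w S' \<and>
        touches_at S s P \<and> touches_at S' s Q \<and> {P, Q} \<in> diagonals s}"

text \<open>A path is recorded with the grid points on it and the lines drawn between them.\<close>

type_synonym path = "point set \<times> point set set"

definition paths ::
    "orientation \<Rightarrow> nat \<Rightarrow> (nat \<Rightarrow> int) \<Rightarrow> (point \<Rightarrow> int) \<Rightarrow> int \<Rightarrow> path set" where
  "paths w n \<pi> d p =
     (let T = type_points n d p; E = unit_lines w T \<union> diagonal_lines w n \<pi> T
      in {(V, {e \<in> E. e \<subseteq> V}) | V. V \<in> components T E})"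

abbreviation h_plus_paths :: "nat \<Rightarrow> (nat \<Rightarrow> int) \<Rightarrow> int \<Rightarrow> path set" where
  "h_plus_paths n \<pi> \<equiv> paths Horizontal n \<pi> (\<lambda>P. fst (d_plus n \<pi> P))"

abbreviation v_plus_paths :: "nat \<Rightarrow> (nat \<Rightarrow> int) \<Rightarrow> int \<Rightarrow> path set" where
  "v_plus_paths n \<pi> \<equiv> paths Vertical n \<pi> (\<lambda>P. snd (d_plus n \<pi> P))"

abbreviation h_minus_paths :: "nat \<Rightarrow> (nat \<Rightarrow> int) \<Rightarrow> int \<Rightarrow> path set" where
  "h_minus_paths n \<pi> \<equiv> paths Horizontal n \<pi> (\<lambda>P. fst (d_minus n \<pi> P))"

abbreviation v_minus_paths :: "nat \<Rightarrow> (nat \<Rightarrow> int) \<Rightarrow> int \<Rightarrow> path set" where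
  "v_minus_paths n \<pi> \<equiv> paths Vertical n \<pi> (\<lambda>P. snd (d_minus n \<pi> P))"


section \<open>The course of a path\<close>

datatype heading = Southeast | Northeast | Southwest

fun crossing :: "heading \<Rightarrow> square \<Rightarrow> point \<times> point" where
  "crossing Southeast (a, b) = ((a, b), (a + 1, b + 1))"
| "crossing Northeast (a, b) = ((a + 1, b), (a, b + 1))"
| "crossing Southwest (a, b) = ((a, b + 1), (a + 1, b))"

text \<open>A traveller going east encounters a square on reaching either end of its west side; going
  south, either end of its north side.\<close>

fun near_corners :: "orientation \<Rightarrow> square \<Rightarrow> point set" where
  "near_corners Horizontal (a, b) = {(a, b), (a + 1, b)}"
| "near_corners Vertical (a, b) = {(a, b), (a, b + 1)}"

definition step :: "orientation \<Rightarrow> square set \<Rightarrow> heading \<Rightarrow> point \<Rightarrow> point \<Rightarrow> bool" where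
  "step w F h P Q \<longleftrightarrow>
     (if \<exists>s \<in> F. P \<in> near_corners w s
      then \<exists>s \<in> F. (P, Q) = crossing h s
      else Q = advance w P)"

text \<open>The boundary sides at which a path of the given orientation should start and end.\<close>

fun first_side :: "nat \<Rightarrow> orientation \<Rightarrow> point set" where
  "first_side n Horizontal = grid_line n Vertical 1"
| "first_side n Vertical = grid_line n Horizontal 1"

fun last_side :: "nat \<Rightarrow> orientation \<Rightarrow> point set" where
  "last_side n Horizontal = grid_line n Vertical (n + 1)"
| "last_side n Vertical = grid_line n Horizontal (n + 1)"

text \<open>The path consists exactly of the points and lines of one walk from the first to the last
  side, which steps along grid lines except that it crosses every square of \<open>F\<close> that it encounters,
  with heading \<open>h\<close>.\<close>

definition traverses :: "orientation \<Rightarrow> nat \<Rightarrow> square set \<Rightarrow> heading \<Rightarrow> path \<Rightarrow> bool" where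
  "traverses w n F h \<gamma> \<longleftrightarrow>
     (\<exists>vs. vs \<noteq> [] \<and> hd vs \<in> first_side n w \<and> last vs \<in> last_side n w \<and>
        (\<forall>k. k + 1 < length vs \<longrightarrow> step w F h (vs ! k) (vs ! (k + 1))) \<and>
        \<gamma> = (set vs, {{vs ! k, vs ! (k + 1)} | k. k + 1 < length vs}))"

end

theory Submission
  imports Defs
begin

text \<open>Inserting \<open>v = \<plusminus>j\<close> between \<open>a = \<pi>\<^bsub>i-1\<^esub>\<close> and \<open>b = \<pi>\<^sub>i\<close> creates no new descent exactly when
  \<open>v\<close> lies in the cyclic interval from \<open>a\<close> to \<open>b\<close> of the \<open>r\<close>-order. As \<open>j\<close> increases, \<open>v\<close> increases in
  the \<open>r\<close>-order, so along a horizontal line the \<open>d\<close>-type changes only where \<open>v\<close> passes \<open>a\<close> or \<open>b\<close>, that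
  is, at a square with the sign of \<open>v\<close> just above or below the line. The corners of such a square
  have types \<open>0, 1\<close> on the upper side and \<open>1, 0\<close> on the lower side, so each type continues exactly
  along one diagonal. Squares of the other sign only see whole sides of one type, hence are not
  touched. Since \<open>(\<phi>\<^bsub>(i,j)\<^esub> \<pi>)\<^sup>-\<^sup>1 = \<phi>\<^bsub>(j,i)\<^esub> (\<pi>\<^sup>-\<^sup>1)\<close>, the vertical paths of \<open>\<pi>\<close> are the
  transposed horizontal paths of the inverse.\<close>

section \<open>Connected components\<close>

lemma components_subset: "C \<in> components V E \<Longrightarrow> C \<subseteq> V"
  by (auto simp: components_def)

lemma components_closed:
  assumes "C \<in> components V E" "x \<in> C" "{x, y} \<in> E" "y \<in> V"
  shows "y \<in> C"
  using assms unfolding components_def by (auto intro: rtrancl_into_rtrancl)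

lemma ex_component:
  assumes "x \<in> V"
  obtains C where "C \<in> components V E" "x \<in> C"
  using assms unfolding components_def by blast

text \<open>Serves to show that a segment stays on one grid line, with \<open>f\<close> the index of
  the line.\<close>

lemma components_invariant:
  assumes C: "C \<in> components V E" "x \<in> C" "y \<in> C"
    and f: "\<And>x y. {x, y} \<in> E \<Longrightarrow> f x = f y"
  shows "f x = f y"
proof -
  have "f u = f v" if "(u, v) \<in> {(u, v). {u, v} \<in> E}\<^sup>*" for u v
    using that
  proof (induction rule: rtrancl_induct)
    case (step y z)
    then have "f y = f z" by (intro f) simp
    with step.IH show ?case by simp
  qed simp
  moreover obtain z where "(z, x) \<in> {(u, v). {u, v} \<in> E}\<^sup>*" "(z, y) \<in> {(u, v). {u, v} \<in> E}\<^sup>*"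
    using C unfolding components_def by blast
  ultimately show ?thesis by metis
qed

text \<open>Every vertex except those on the last level has a unique successor, and every vertex except
  those on the first level has a unique predecessor, so a component is one walk through all levels.\<close>

lemma component_walk:
  fixes lev :: "'a \<Rightarrow> nat" and R :: "'a \<Rightarrow> 'a \<Rightarrow> bool"
  assumes C: "C \<in> components V {{x, y} | x y. R x y}"
    and lev: "\<And>x. x \<in> V \<Longrightarrow> 1 \<le> lev x \<and> lev x \<le> N"
    and R: "\<And>x y. R x y \<Longrightarrow> x \<in> V \<and> y \<in> V \<and> lev y = lev x + 1"
    and succ: "\<And>x. x \<in> V \<Longrightarrow> lev x < N \<Longrightarrow> \<exists>y. R x y"
    and pred: "\<And>y. y \<in> V \<Longrightarrow> 1 < lev y \<Longrightarrow> \<exists>x. R x y"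
    and runique: "\<And>x y y'. R x y \<Longrightarrow> R x y' \<Longrightarrow> y = y'"
    and lunique: "\<And>x x' y. R x y \<Longrightarrow> R x' y \<Longrightarrow> x = x'"
  obtains vs where "vs \<noteq> []" "set vs = C" "lev (hd vs) = 1" "lev (last vs) = N"
    "\<forall>k. k + 1 < length vs \<longrightarrow> R (vs ! k) (vs ! (k + 1))"
    "{e \<in> {{x, y} | x y. R x y}. e \<subseteq> C} = {{vs ! k, vs ! (k + 1)} | k. k + 1 < length vs}"
proof -
  let ?E = "{{x, y} | x y. R x y}"
  let ?A = "{(u, v). {u, v} \<in> ?E}"
  obtain x0 where x0: "x0 \<in> V" "C = {y \<in> V. (x0, y) \<in> ?A\<^sup>*}"
    using C unfolding components_def by blast
  have x0C: "x0 \<in> C" using x0 by auto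
  have CV: "C \<subseteq> V" using components_subset[OF C] .
  \<comment> \<open>Each predecessor is one level lower and in the same component, so level 1 is
    reached.\<close>
  have "\<exists>s. s \<in> C \<and> lev s = 1" if "x \<in> C" "lev x = Suc m" for x m
    using that
  proof (induction m arbitrary: x)
    case (Suc m)
    then obtain y where y: "R y x" using pred[of x] CV by auto
    have "{x, y} \<in> ?E" using y by (auto simp: doubleton_eq_iff)
    then have "y \<in> C"
      using components_closed[OF C Suc.prems(1)] R[OF y] by blast
    then show ?case using Suc.IH[of y] R[OF y] Suc.prems by simp
  qed auto
  moreover obtain m where "lev x0 = Suc m" using lev[OF x0(1)] by (cases "lev x0") auto
  ultimately obtain s where s: "s \<in> C" "lev s = 1" using x0C by blast
  have N: "1 \<le> N" using lev[OF x0(1)] by linarith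
  \<comment> \<open>On the last level \<open>nxt\<close> is arbitrary, so the iterates
    \<open>f k\<close> are considered for \<open>k < N\<close> only, where \<open>f k\<close> has
    level \<open>k + 1\<close>.\<close>
  define nxt where "nxt x = (SOME y. R x y)" for x
  have nxt: "R x (nxt x)" if "x \<in> V" "lev x < N" for x
    unfolding nxt_def by (rule someI_ex) (rule succ[OF that])
  define f where "f k = (nxt ^^ k) s" for k
  have f0: "f 0 = s" and fS: "f (Suc k) = nxt (f k)" for k by (auto simp: f_def)
  have fC: "f k \<in> C \<and> lev (f k) = k + 1" if "k < N" for k
    using that
  proof (induction k)
    case (Suc k)
    then have k: "f k \<in> C" "lev (f k) = k + 1" by auto
    then have r: "R (f k) (f (Suc k))" using nxt[of "f k"] CV Suc.prems by (auto simp: fS)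
    then show ?case using components_closed[OF C k(1), of "f (Suc k)"] R[OF r] k r by fastforce
  qed (simp add: f0 s)
  have fR: "R (f k) (f (k + 1))" if "k + 1 < N" for k
    using nxt[of "f k"] fC[of k] CV that by (auto simp: fS)
  \<comment> \<open>Edges are undirected: a neighbour of \<open>f k\<close> is a successor, hence
    \<open>f (k + 1)\<close>, or a predecessor, hence \<open>f (k - 1)\<close>. The levels prevent
    leaving at either end.\<close>
  have path_step: "\<exists>k'<N. v = f k'" if "k < N" "{f k, v} \<in> ?E" for k v
  proof -
    from that(2) consider "R (f k) v" | "R v (f k)"
      by (auto simp: doubleton_eq_iff)
    then show ?thesis
    proof cases
      case 1
      then have k: "k + 1 < N" using R[OF 1] lev[of v] fC[OF that(1)] by auto
      then show ?thesis using runique[OF 1 fR[OF k]] by auto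
    next
      case 2
      then have "k \<noteq> 0" using R[OF 2] lev[of v] fC[OF that(1)] by auto
      then obtain j where j: "k = j + 1" by (metis Suc_eq_plus1 not0_implies_Suc)
      then have "R (f j) (f k)" using fR[of j] that by auto
      then show ?thesis using lunique[OF 2] j that(1) by (metis add_lessD1)
    qed
  qed
  have reach: "\<exists>k<N. v = f k" if "(f k, v) \<in> ?A\<^sup>*" "k < N" for k v
    using that(1)
  proof (induction rule: rtrancl_induct)
    case (step u v)
    then obtain k' where "k' < N" "u = f k'" by blast
    then show ?case using path_step step.hyps(2) by blast
  qed (use that(2) in blast)
  \<comment> \<open>The component is described from its base point \<open>x0\<close>; symmetry makes
    all of it reachable from the start \<open>s\<close>.\<close>
  have "sym ?A" by (rule symI) (simp add: insert_commute)
  then have "sym (?A\<^sup>*)" by (rule sym_rtrancl)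
  have Cf: "C = f ` {..<N}"
  proof (intro equalityI subsetI)
    fix y assume "y \<in> C"
    then have "(s, x0) \<in> ?A\<^sup>*" "(x0, y) \<in> ?A\<^sup>*"
      using s x0 \<open>sym (?A\<^sup>*)\<close> by (auto dest: symD)
    then have "(f 0, y) \<in> ?A\<^sup>*" unfolding f0 by (rule rtrancl_trans)
    then show "y \<in> f ` {..<N}" using reach[of 0 y] N by auto
  qed (use fC in auto)
  define vs where "vs = map f [0..<N]"
  have len: "length vs = N" and nth: "\<And>k. k < N \<Longrightarrow> vs ! k = f k"
    by (auto simp: vs_def)
  show thesis
  proof
    show ne: "vs \<noteq> []" using N len by auto
    show "set vs = C" by (auto simp: Cf vs_def)
    show "lev (hd vs) = 1" using ne N by (simp add: hd_conv_nth nth f0 s)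
    show "lev (last vs) = N" using ne N fC[of "N - 1"] by (simp add: last_conv_nth nth len)
    show "\<forall>k. k + 1 < length vs \<longrightarrow> R (vs ! k) (vs ! (k + 1))"
      using fR by (simp add: nth len)
    \<comment> \<open>An edge inside the component starts at some \<open>f k\<close>, and uniqueness
      of successors forces its other end, so there are no chords.\<close>
    have "e \<in> {{f k, f (k + 1)} | k. k + 1 < N}" if "e \<in> ?E" "e \<subseteq> C" for e
    proof -
      from that obtain x y where e: "e = {x, y}" "R x y" "x \<in> C" by auto
      then obtain k where k: "x = f k" "k < N" by (auto simp: Cf)
      then have kN: "k + 1 < N" using R[OF e(2)] lev[of y] fC[of k] by auto
      then have "y = f (k + 1)" using runique[OF e(2)] fR k by auto
      then show ?thesis using e k kN by auto
    qed
    moreover have "{f k, f (k + 1)} \<in> ?E \<and> {f k, f (k + 1)} \<subseteq> C" if "k + 1 < N" for k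
      using fR[OF that] fC[of k] fC[of "k + 1"] that by auto
    ultimately have "{e \<in> ?E. e \<subseteq> C} = {{f k, f (k + 1)} | k. k + 1 < N}"
      by blast
    also have "\<dots> = {{vs ! k, vs ! (k + 1)} | k. k + 1 < length vs}"
      by (intro Collect_cong ex_cong1) (auto simp: len nth)
    finally show "{e \<in> ?E. e \<subseteq> C} = {{vs ! k, vs ! (k + 1)} | k. k + 1 < length vs}" .
  qed
qed


section \<open>The effect of an insertion on the descents\<close>

lemma shift_0 [simp]: "1 \<le> j \<Longrightarrow> shift j 0 = 0"
  by (simp add: shift_def)

lemma r_less_shift [simp]: "1 \<le> j \<Longrightarrow> shift j x <\<^sub>r shift j y \<longleftrightarrow> x <\<^sub>r y"
  by (auto simp: shift_def r_less_def)

lemma r_less_irrefl: "\<not> x <\<^sub>r x"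
  by (simp add: r_less_def)

lemma r_less_total: "x \<noteq> y \<Longrightarrow> x <\<^sub>r y \<longleftrightarrow> \<not> y <\<^sub>r x"
  by (auto simp: r_less_def)

text \<open>The shift moves an entry equal to the new one away from 0, which is upwards in the
  r-order for either sign; it keeps all other comparisons with the new entry.\<close>

lemma r_less_inserted:
  assumes "1 \<le> j" "\<epsilon> \<in> {1, - 1}"
  shows "\<epsilon> * int j <\<^sub>r shift j x \<longleftrightarrow> \<not> x <\<^sub>r \<epsilon> * int j"
    and "shift j x <\<^sub>r \<epsilon> * int j \<longleftrightarrow> x <\<^sub>r \<epsilon> * int j"
  using assms by (auto simp: shift_def r_less_def)

lemma des_B_sum: "int (des_B n \<pi>) = (\<Sum>i<n. of_bool (\<pi> (i + 1) <\<^sub>r \<pi> i))"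
proof -
  have "{..<n} \<inter> {i. \<pi> (i + 1) <\<^sub>r \<pi> i} = {i \<in> {0..<n}. \<pi> (i + 1) <\<^sub>r \<pi> i}" by auto
  then show ?thesis by (simp add: des_B_def sum_of_bool_eq)
qed

lemma des_B_Suc: "int (des_B (Suc n) \<pi>) = int (des_B n \<pi>) + of_bool (\<pi> (n + 1) <\<^sub>r \<pi> n)"
  by (simp add: des_B_sum)

lemma des_B_cong: "(\<And>i. i \<le> n \<Longrightarrow> \<pi> i = \<sigma> i) \<Longrightarrow> des_B n \<pi> = des_B n \<sigma>"
  unfolding des_B_def by (rule arg_cong[where f = card]) auto

lemma des_B_shift: "1 \<le> j \<Longrightarrow> des_B n (\<lambda>i. shift j (\<pi> i)) = des_B n \<pi>"
  by (simp add: des_B_def)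

text \<open>The new entry \<open>v\<close> is compared with the entries before the shift; an old entry equal to \<open>v\<close>
  is moved above \<open>v\<close> in the \<open>r\<close>-order by the shift, so it counts as greater.\<close>

definition jump :: "nat \<Rightarrow> int \<Rightarrow> (nat \<Rightarrow> int) \<Rightarrow> nat \<Rightarrow> int" where
  "jump n v \<rho> k = of_bool (\<not> \<rho> (k - 1) <\<^sub>r v) +
     (if k \<le> n then of_bool (\<rho> k <\<^sub>r v) - of_bool (\<rho> k <\<^sub>r \<rho> (k - 1)) else 0)"

text \<open>For \<open>i \<le> n\<close> one old comparison gives way to two new ones; at the end
  \<open>i = n + 1\<close> there is just one new comparison, with the left neighbour.\<close>

lemma des_B_insert_entry:
  assumes "1 \<le> j" "\<epsilon> \<in> {1, - 1}" "1 \<le> i" "i \<le> n + 1"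
  shows "int (des_B (n + 1) (insert_entry i j (\<epsilon> * int j) \<pi>)) - int (des_B n \<pi>) =
    jump n (\<epsilon> * int j) \<pi> i"
proof -
  define \<sigma> where "\<sigma> = insert_entry i j (\<epsilon> * int j) \<pi>"
  have before: "\<sigma> k = shift j (\<pi> k)" if "k < i" for k
    using that by (simp add: \<sigma>_def insert_entry_def)
  have at: "\<sigma> i = \<epsilon> * int j"
    by (simp add: \<sigma>_def insert_entry_def)
  have after: "\<sigma> k = shift j (\<pi> (k - 1))" if "i < k" for k
    using that by (simp add: \<sigma>_def insert_entry_def)
  note cmp = r_less_inserted[OF assms(1,2)] r_less_shift[OF assms(1)]
  \<comment> \<open>Besides the case of a last new entry, this gives the count just before its right
    neighbour is appended.\<close>
  have last: "int (des_B (m + 1) \<sigma>) - int (des_B m \<pi>) = of_bool (\<not> \<pi> m <\<^sub>r \<epsilon> * int j)"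
    if "i = m + 1" for m
  proof -
    have "des_B m \<sigma> = des_B m (\<lambda>k. shift j (\<pi> k))"
      by (rule des_B_cong) (simp add: before that)
    moreover have "\<sigma> (m + 1) = \<epsilon> * int j" "\<sigma> m = shift j (\<pi> m)"
      using at before[of m] that by simp_all
    ultimately show ?thesis
      using des_B_Suc[of m \<sigma>] assms(1) by (simp add: des_B_shift cmp)
  qed
  \<comment> \<open>\<open>\<sigma>\<close> does not depend on \<open>n\<close>, so the induction
    lengthens the prefix entry by entry. Once both compared entries lie beyond \<open>i\<close>, the
    two descent counts grow alike.\<close>
  have "int (des_B (n + 1) \<sigma>) - int (des_B n \<pi>) = jump n (\<epsilon> * int j) \<pi> i"
    using assms(4)
  proof (induction n)
    case 0
    then show ?case using last[of 0] assms(3) by (simp add: jump_def)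
  next
    case (Suc n)
    consider "i = n + 2" | "i = n + 1" | "i \<le> n" using Suc.prems by linarith
    then show ?case
    proof cases
      case 1
      then show ?thesis using last[of "n + 1"] by (simp add: jump_def)
    next
      case 2
      have "\<sigma> (n + 2) = shift j (\<pi> (n + 1))" "\<sigma> (n + 1) = \<epsilon> * int j"
        using after[of "n + 2"] at 2 by simp_all
      then show ?thesis
        using last[of n] des_B_Suc[of "n + 1" \<sigma>] des_B_Suc[of n \<pi>] 2
        by (simp add: jump_def cmp)
    next
      case 3
      have "\<sigma> (n + 2) = shift j (\<pi> (n + 1))" "\<sigma> (n + 1) = shift j (\<pi> n)"
        using after[of "n + 2"] after[of "n + 1"] 3 by simp_all
      then show ?thesis
        using Suc.IH des_B_Suc[of "n + 1" \<sigma>] des_B_Suc[of n \<pi>] 3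
        by (simp add: jump_def cmp)
    qed
  qed
  then show ?thesis by (simp add: \<sigma>_def)
qed


section \<open>Signed permutations and their inverses\<close>

lemma signed_perms_nonzero: "\<pi> \<in> signed_perms n \<Longrightarrow> i \<in> {1..n} \<Longrightarrow> nat \<bar>\<pi> i\<bar> \<in> {1..n}"
  unfolding signed_perms_def by (auto dest: bij_betwE)

lemma signed_perms_outside: "\<pi> \<in> signed_perms n \<Longrightarrow> i \<notin> {1..n} \<Longrightarrow> \<pi> i = 0"
  unfolding signed_perms_def by blast

lemma signed_perms_inj:
  "\<pi> \<in> signed_perms n \<Longrightarrow> i \<in> {1..n} \<Longrightarrow> k \<in> {1..n} \<Longrightarrow> \<bar>\<pi> i\<bar> = \<bar>\<pi> k\<bar> \<Longrightarrow> i = k"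
  using inj_onD[of "\<lambda>i. nat \<bar>\<pi> i\<bar>" "{1..n}" i k] by (simp add: signed_perms_def bij_betw_def)

lemma signed_perms_surj:
  assumes "\<pi> \<in> signed_perms n" "m \<in> {1..n}"
  obtains i where "i \<in> {1..n}" "\<bar>\<pi> i\<bar> = int m"
proof -
  have "m \<in> (\<lambda>i. nat \<bar>\<pi> i\<bar>) ` {1..n}"
    using assms by (simp add: signed_perms_def bij_betw_def)
  then show thesis using that assms(2) by auto
qed

lemma signed_permsI:
  assumes "\<And>i. i \<in> {1..n} \<Longrightarrow> nat \<bar>\<pi> i\<bar> \<in> {1..n}"
    and "\<And>i k. i \<in> {1..n} \<Longrightarrow> k \<in> {1..n} \<Longrightarrow> \<bar>\<pi> i\<bar> = \<bar>\<pi> k\<bar> \<Longrightarrow> i = k"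
    and "\<And>i. i \<notin> {1..n} \<Longrightarrow> \<pi> i = 0"
  shows "\<pi> \<in> signed_perms n"
proof -
  have "inj_on (\<lambda>i. nat \<bar>\<pi> i\<bar>) {1..n}"
    by (rule inj_onI, rule assms(2)) simp_all
  moreover from this have "(\<lambda>i. nat \<bar>\<pi> i\<bar>) ` {1..n} = {1..n}"
    by (intro endo_inj_surj image_subsetI assms(1) finite_atLeastAtMost)
  ultimately show ?thesis
    using assms(3) by (simp add: signed_perms_def bij_betw_def)
qed

lemma signed_inv_eq:
  assumes "\<pi> \<in> signed_perms n" "i \<in> {1..n}" "\<bar>\<pi> i\<bar> = int m"
  shows "signed_inv n \<pi> m = sgn (\<pi> i) * int i"
proof -
  have "the_inv_into {1..n} (\<lambda>i. nat \<bar>\<pi> i\<bar>) m = i"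
    using assms by (intro the_inv_into_f_eq) (auto simp: signed_perms_def bij_betw_def)
  moreover have "m \<in> {1..n}" using signed_perms_nonzero[OF assms(1,2)] assms(3) by simp
  ultimately show ?thesis by (simp add: signed_inv_def)
qed

text \<open>Inversion keeps signs, so transposing the grid turns the squares of \<open>\<pi>\<close>
  into those of its inverse, sign by sign. For an index beyond \<open>n\<close> both sides are
  false.\<close>

lemma signed_inv_eq_iff:
  assumes "\<pi> \<in> signed_perms n" "\<epsilon> \<in> {1, - 1}" "1 \<le> i" "1 \<le> m"
  shows "signed_inv n \<pi> m = \<epsilon> * int i \<longleftrightarrow> \<pi> i = \<epsilon> * int m"
proof
  assume l: "signed_inv n \<pi> m = \<epsilon> * int i"
  then have "m \<in> {1..n}" using assms by (auto simp: signed_inv_def split: if_splits)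
  then obtain k where k: "k \<in> {1..n}" "\<bar>\<pi> k\<bar> = int m"
    using signed_perms_surj[OF assms(1)] by blast
  then have "sgn (\<pi> k) * int k = \<epsilon> * int i" using signed_inv_eq[OF assms(1) k] l by simp
  then show "\<pi> i = \<epsilon> * int m"
    using k assms by (auto simp: sgn_if abs_if split: if_splits)
next
  assume r: "\<pi> i = \<epsilon> * int m"
  then have "i \<in> {1..n}" using signed_perms_outside[OF assms(1), of i] assms by fastforce
  then show "signed_inv n \<pi> m = \<epsilon> * int i"
    using signed_inv_eq[OF assms(1), of i m] r assms by auto
qed

lemma signed_inv_in_signed_perms:
  assumes "\<pi> \<in> signed_perms n"
  shows "signed_inv n \<pi> \<in> signed_perms n"
proof -
  have *: "\<exists>i \<in> {1..n}. \<bar>\<pi> i\<bar> = int m \<and> \<bar>signed_inv n \<pi> m\<bar> = int i" if m: "m \<in> {1..n}" for m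
  proof -
    obtain i where i: "i \<in> {1..n}" "\<bar>\<pi> i\<bar> = int m" using signed_perms_surj[OF assms m] .
    then show ?thesis
      using signed_inv_eq[OF assms i] m by (auto simp: abs_mult abs_sgn_eq)
  qed
  show ?thesis
  proof (rule signed_permsI)
    show "nat \<bar>signed_inv n \<pi> m\<bar> \<in> {1..n}" if "m \<in> {1..n}" for m
      using *[OF that] by (elim bexE conjE) simp
    show "m = k" if "m \<in> {1..n}" "k \<in> {1..n}" "\<bar>signed_inv n \<pi> m\<bar> = \<bar>signed_inv n \<pi> k\<bar>" for m k
      using *[OF that(1)] *[OF that(2)] that(3) by (elim bexE conjE) simp
    show "signed_inv n \<pi> m = 0" if "m \<notin> {1..n}" for m
      using that by (simp only: signed_inv_def if_False)
  qed
qed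

lemma insert_entry_in_signed_perms:
  assumes \<pi>: "\<pi> \<in> signed_perms n" and i: "i \<in> {1..n + 1}" and j: "j \<in> {1..n + 1}"
    and \<epsilon>: "\<epsilon> \<in> {1, - 1}"
  shows "insert_entry i j (\<epsilon> * int j) \<pi> \<in> signed_perms (n + 1)"
proof (rule signed_permsI)
  \<comment> \<open>For \<open>k \<noteq> i\<close>, \<open>pos k\<close> is the old position of the
    entry that stands at \<open>k\<close> after the insertion.\<close>
  define pos where "pos k = (if k < i then k else k - 1)" for k
  have pos: "pos k \<in> {1..n}" if "k \<in> {1..n + 1}" "k \<noteq> i" for k
    using that i by (auto simp: pos_def)
  have other: "insert_entry i j (\<epsilon> * int j) \<pi> k = shift j (\<pi> (pos k))" if "k \<noteq> i" for k
    using that by (simp add: insert_entry_def pos_def)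
  have at: "insert_entry i j (\<epsilon> * int j) \<pi> i = \<epsilon> * int j" by (simp add: insert_entry_def)
  \<comment> \<open>The shift frees the absolute value \<open>j\<close> for the new entry and is
    injective on absolute values.\<close>
  have abs_shift: "\<bar>shift j x\<bar> \<noteq> int j" for x by (auto simp: shift_def)
  have abs_shift_inj: "\<bar>shift j x\<bar> = \<bar>shift j y\<bar> \<Longrightarrow> \<bar>x\<bar> = \<bar>y\<bar>" for x y
    using j by (auto simp: shift_def split: if_splits)
  show "nat \<bar>insert_entry i j (\<epsilon> * int j) \<pi> k\<bar> \<in> {1..n + 1}" if k: "k \<in> {1..n + 1}" for k
  proof (cases "k = i")
    case False
    then show ?thesis
      using signed_perms_nonzero[OF \<pi> pos[OF k False]] other[OF False] by (auto simp: shift_def)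
  qed (use at j \<epsilon> in auto)
  show "k = l" if "k \<in> {1..n + 1}" "l \<in> {1..n + 1}"
    "\<bar>insert_entry i j (\<epsilon> * int j) \<pi> k\<bar> = \<bar>insert_entry i j (\<epsilon> * int j) \<pi> l\<bar>" for k l
  proof (cases "k = i \<or> l = i")
    case True
    have "\<bar>insert_entry i j (\<epsilon> * int j) \<pi> m\<bar> = int j \<longleftrightarrow> m = i" for m
      using \<epsilon> at other[of m] abs_shift[of "\<pi> (pos m)"] by (cases "m = i") (auto simp: abs_mult)
    with True that(3) show ?thesis by metis
  next
    case False
    then have ne: "k \<noteq> i" "l \<noteq> i" by auto
    have "\<bar>\<pi> (pos k)\<bar> = \<bar>\<pi> (pos l)\<bar>"
      using that(3) unfolding other[OF ne(1)] other[OF ne(2)] by (rule abs_shift_inj)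
    then have "pos k = pos l"
      by (rule signed_perms_inj[OF \<pi> pos[OF that(1) ne(1)] pos[OF that(2) ne(2)]])
    then show ?thesis using ne by (auto simp: pos_def split: if_splits)
  qed
  show "insert_entry i j (\<epsilon> * int j) \<pi> k = 0" if "k \<notin> {1..n + 1}" for k
  proof -
    have "k \<noteq> i" "pos k \<notin> {1..n}" using that i by (auto simp: pos_def)
    then show ?thesis using signed_perms_outside[OF \<pi>] other j by simp
  qed
qed

lemma signed_inv_insert_entry:
  assumes \<pi>: "\<pi> \<in> signed_perms n" and i: "i \<in> {1..n + 1}" and j: "j \<in> {1..n + 1}"
    and \<epsilon>: "\<epsilon> \<in> {1, - 1}"
  shows "signed_inv (n + 1) (insert_entry i j (\<epsilon> * int j) \<pi>) =
    insert_entry j i (\<epsilon> * int i) (signed_inv n \<pi>)" (is "signed_inv _ ?\<sigma> = ?\<tau>")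
proof
  fix m
  have \<sigma>: "?\<sigma> \<in> signed_perms (n + 1)" by (rule insert_entry_in_signed_perms[OF assms])
  have \<tau>: "?\<tau> \<in> signed_perms (n + 1)"
    by (rule insert_entry_in_signed_perms[OF signed_inv_in_signed_perms[OF \<pi>] j i \<epsilon>])
  show "signed_inv (n + 1) ?\<sigma> m = ?\<tau> m"
  proof (cases "m \<in> {1..n + 1}")
    case True
    then obtain k where k: "k \<in> {1..n + 1}" "\<bar>?\<sigma> k\<bar> = int m"
      using signed_perms_surj[OF \<sigma>] by blast
    define p where "p = (if k < i then k else k - 1)"
    have "?\<tau> m = sgn (?\<sigma> k) * int k"
    proof (cases "k = i")
      case True
      then show ?thesis using k j \<epsilon> by (auto simp: insert_entry_def)
    next
      case False
      then have \<sigma>k: "?\<sigma> k = shift j (\<pi> p)" and p: "p \<in> {1..n}"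
        using k(1) i by (auto simp: insert_entry_def p_def)
      have inv: "signed_inv n \<pi> (nat \<bar>\<pi> p\<bar>) = sgn (\<pi> p) * int p"
        using signed_inv_eq[OF \<pi> p] by simp
      have nz: "\<pi> p \<noteq> 0" using signed_perms_nonzero[OF \<pi> p] by auto
      \<comment> \<open>Here \<open>m\<close> differs from \<open>j\<close>, so
        \<open>?\<tau>\<close> reads the inverse at the unshifted absolute value of
        \<open>\<pi> p\<close>, and the shift by \<open>i\<close> turns the old position
        \<open>p\<close> back into \<open>k\<close>.\<close>
      have m: "m = (if nat \<bar>\<pi> p\<bar> < j then nat \<bar>\<pi> p\<bar> else nat \<bar>\<pi> p\<bar> + 1)"
        using k(2) \<sigma>k by (auto simp: shift_def split: if_splits)
      then have "?\<tau> m = shift i (sgn (\<pi> p) * int p)"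
        using inv by (auto simp: insert_entry_def)
      also have "\<dots> = sgn (\<pi> p) * int k"
        using nz False k(1) i by (auto simp: shift_def p_def sgn_if)
      also have "sgn (\<pi> p) = sgn (?\<sigma> k)"
        using nz j by (auto simp: \<sigma>k shift_def sgn_if)
      finally show ?thesis .
    qed
    then show ?thesis using signed_inv_eq[OF \<sigma> k] by simp
  next
    case False
    then show ?thesis
      using signed_perms_outside[OF \<tau>] signed_perms_outside[OF signed_inv_in_signed_perms[OF \<sigma>]]
      by simp
  qed
qed


section \<open>The course of the paths\<close>

text \<open>The point, or square, with index \<open>k\<close> across and index \<open>c\<close> along the direction of travel.\<close>

fun pt :: "orientation \<Rightarrow> nat \<Rightarrow> nat \<Rightarrow> point" where
  "pt Horizontal k c = (k, c)"
| "pt Vertical k c = (c, k)"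

lemma pt_eq_iff [simp]: "pt w k c = pt w k' c' \<longleftrightarrow> k = k' \<and> c = c'"
  by (cases w) auto

lemma pt_exhaust: obtains k c where "P = pt w k c"
  by (cases w; cases P) (metis pt.simps)+

fun lev :: "orientation \<Rightarrow> point \<Rightarrow> nat" where
  "lev Horizontal (i, j) = j"
| "lev Vertical (i, j) = i"

fun line :: "orientation \<Rightarrow> point \<Rightarrow> nat" where
  "line Horizontal (i, j) = i"
| "line Vertical (i, j) = j"

lemma lev_pt [simp]: "lev w (pt w k c) = c"
  and line_pt [simp]: "line w (pt w k c) = k"
  by (cases w; simp)+

lemma advance_pt [simp]: "advance w (pt w k c) = pt w k (c + 1)"
  by (cases w) auto

lemma corners_pt:
  "corners (pt w r c) = {pt w r c, pt w (r + 1) c, pt w r (c + 1), pt w (r + 1) (c + 1)}"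
  by (cases w) auto

lemma diagonals_pt:
  "diagonals (pt w r c) = {{pt w r c, pt w (r + 1) (c + 1)}, {pt w (r + 1) c, pt w r (c + 1)}}"
  by (cases w) auto

lemma near_corners_pt: "near_corners w (pt w r c) = {pt w r c, pt w (r + 1) c}"
  by (cases w) auto

lemma pt_in_grid_points [simp]: "pt w k c \<in> grid_points n \<longleftrightarrow> k \<in> {1..n + 1} \<and> c \<in> {1..n + 1}"
  by (cases w) (auto simp: grid_points_def)

lemma pt_in_grid_line [simp]: "pt w k c \<in> grid_line n w l \<longleftrightarrow> k = l \<and> c \<in> {1..n + 1}"
  by (cases w) auto

lemma pt_in_first_side [simp]: "pt w k c \<in> first_side n w \<longleftrightarrow> k \<in> {1..n + 1} \<and> c = 1"
  by (cases w) auto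

lemma pt_in_last_side [simp]: "pt w k c \<in> last_side n w \<longleftrightarrow> k \<in> {1..n + 1} \<and> c = n + 1"
  by (cases w) auto

text \<open>The second argument is the type of the path. Type 1 reverses the sideways motion of type
  0, which reads northeast when travelling east and southwest when travelling south.\<close>

fun heading_of :: "orientation \<Rightarrow> nat \<Rightarrow> heading" where
  "heading_of w 0 = Southeast"
| "heading_of Horizontal (Suc t) = Northeast"
| "heading_of Vertical (Suc t) = Southwest"

lemma crossing_pt:
  "t \<in> {0, 1} \<Longrightarrow>
    crossing (heading_of w t) (pt w r c) = (pt w (r + t) c, pt w (r + 1 - t) (c + 1))"
  by (cases w) auto

text \<open>For the horizontal paths \<open>\<rho>\<close> is \<open>\<pi>\<close> itself, for the vertical ones it is the inverse of
  \<open>\<pi>\<close>; \<open>\<epsilon>\<close> is the sign of the inserted entry.\<close>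

locale typed_grid =
  fixes w :: orientation and n :: nat and \<pi> \<rho> :: "nat \<Rightarrow> int" and \<epsilon> :: int
    and F :: "square set" and d :: "point \<Rightarrow> int"
  assumes \<rho>: "\<rho> \<in> signed_perms n"
    and \<epsilon>: "\<epsilon> \<in> {1, - 1}"
    and filled: "pt w r c \<in> filled_squares n \<pi> \<longleftrightarrow> r \<in> {1..n} \<and> \<bar>\<rho> r\<bar> = int c"
    and F: "pt w r c \<in> F \<longleftrightarrow> r \<in> {1..n} \<and> 1 \<le> c \<and> \<rho> r = \<epsilon> * int c"
    and d: "k \<in> {1..n + 1} \<Longrightarrow> c \<in> {1..n + 1} \<Longrightarrow> d (pt w k c) = jump n (\<epsilon> * int c) \<rho> k"
begin

section \<open>Squares and the types at their corners\<close>

lemma F_filled: "F \<subseteq> filled_squares n \<pi>"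
proof
  fix s assume "s \<in> F"
  then show "s \<in> filled_squares n \<pi>"
    using \<epsilon> by (cases rule: pt_exhaust[of s w]) (auto simp: F filled)
qed

lemma filled_col:
  "pt w r c \<in> filled_squares n \<pi> \<Longrightarrow> pt w r' c \<in> filled_squares n \<pi> \<Longrightarrow> r = r'"
  using signed_perms_inj[OF \<rho>, of r r'] by (simp add: filled)

lemma F_col: "pt w r c \<in> F \<Longrightarrow> pt w r' c \<in> F \<Longrightarrow> r = r'"
  using filled_col[of r c r'] subsetD[OF F_filled] by simp

lemma filled_bounds: "pt w r c \<in> filled_squares n \<pi> \<Longrightarrow> r \<in> {1..n} \<and> c \<in> {1..n}"
  using signed_perms_nonzero[OF \<rho>, of r] by (simp add: filled)

text \<open>The two multiples of \<open>\<epsilon>\<close> are consecutive in the r-order, so only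
  an entry equal to the smaller one can tell them apart.\<close>

lemma r_less_next:
  "1 \<le> c \<Longrightarrow> x \<noteq> \<epsilon> * int c \<Longrightarrow> x <\<^sub>r \<epsilon> * int (c + 1) \<longleftrightarrow> x <\<^sub>r \<epsilon> * int c"
  using \<epsilon> by (auto simp: r_less_def)

lemma r_less_entry_Suc: "1 \<le> c \<Longrightarrow> \<epsilon> * int c <\<^sub>r \<epsilon> * int (c + 1)"
  using \<epsilon> by (auto simp: r_less_def)

text \<open>The type depends on comparisons with \<open>\<rho> (k - 1)\<close> and
  \<open>\<rho> k\<close> only, and a comparison changes only when the new entry passes one of
  these, that is, at a square of \<open>F\<close> beside the line.\<close>

lemma d_advance:
  assumes "k \<in> {1..n + 1}" "c \<in> {1..n}" "pt w k c \<notin> F" "pt w (k - 1) c \<notin> F"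
  shows "d (pt w k (c + 1)) = d (pt w k c)"
proof -
  \<comment> \<open>On the first line the preceding entry is \<open>\<rho> 0 = 0\<close>, which the
    new entry never equals.\<close>
  have "\<rho> (k - 1) \<noteq> \<epsilon> * int c"
  proof (cases "k = 1")
    case True
    then show ?thesis using signed_perms_outside[OF \<rho>, of 0] assms(2) \<epsilon> by auto
  qed (use assms in \<open>auto simp: F\<close>)
  moreover have "\<rho> k \<noteq> \<epsilon> * int c" if "k \<le> n" using that assms by (auto simp: F)
  ultimately show ?thesis
    using assms r_less_next[of c "\<rho> (k - 1)"] r_less_next[of c "\<rho> k"] d[of k c] d[of k "c + 1"]
    by (simp add: jump_def)
qed

text \<open>\<open>\<rho> r\<close> counts as greater than the new entry at level \<open>c\<close>
  and as smaller at level \<open>c + 1\<close>. The comparison with the outer neighbour is the same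
  at both levels and cancels against the old one.\<close>

lemma d_square:
  assumes "pt w r c \<in> F"
  shows "d (pt w r c) = 0" "d (pt w r (c + 1)) = 1"
    "d (pt w (r + 1) c) = 1" "d (pt w (r + 1) (c + 1)) = 0"
proof -
  have bounds: "r \<in> {1..n}" "c \<in> {1..n}" using assms F_filled filled_bounds by blast+
  have \<rho>r: "\<rho> r = \<epsilon> * int c" using assms F by blast
  have above: "\<rho> (r - 1) \<noteq> \<epsilon> * int c"
  proof (cases "r = 1")
    case True
    then show ?thesis using \<rho>r signed_perms_outside[OF \<rho>, of 0] bounds \<epsilon> by auto
  next
    case False
    then have "r - 1 \<in> {1..n}" "r - 1 \<noteq> r" using bounds by auto
    then have "\<rho> (r - 1) \<noteq> \<rho> r" using signed_perms_inj[OF \<rho> _ bounds(1)] by metis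
    then show ?thesis by (simp add: \<rho>r)
  qed
  show "d (pt w r c) = 0"
    using bounds d[of r c] r_less_total[OF above] by (simp add: jump_def \<rho>r r_less_irrefl)
  show "d (pt w r (c + 1)) = 1"
    using bounds d[of r "c + 1"] r_less_total[OF above] r_less_next[OF _ above]
      r_less_entry_Suc[of c] by (simp add: jump_def \<rho>r)
  have below: "\<rho> (r + 1) \<noteq> \<epsilon> * int c" if "r + 1 \<le> n"
  proof -
    have "\<rho> (r + 1) \<noteq> \<rho> r" using signed_perms_inj[OF \<rho>, of "r + 1" r] bounds that by auto
    then show ?thesis by (simp add: \<rho>r)
  qed
  show "d (pt w (r + 1) c) = 1"
    using bounds d[of "r + 1" c] by (simp add: jump_def \<rho>r r_less_irrefl)
  show "d (pt w (r + 1) (c + 1)) = 0"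
    using bounds d[of "r + 1" "c + 1"] r_less_entry_Suc[of c] r_less_next[OF _ below]
    by (simp add: jump_def \<rho>r)
qed

text \<open>The type \<open>t\<close> is a natural number because it doubles as an offset: a path of
  type \<open>t\<close> enters a square on line \<open>r + t\<close> and leaves it on line
  \<open>r + 1 - t\<close>.\<close>

context
  fixes t :: nat and T :: "point set"
  assumes t: "t \<in> {0, 1}"
  defines "T \<equiv> type_points n d (int t)"
begin

lemma T_bounds: "pt w k c \<in> T \<Longrightarrow> k \<in> {1..n + 1} \<and> c \<in> {1..n + 1}"
  by (simp add: T_def type_points_def)

lemma T_advance:
  assumes "c \<in> {1..n}" "pt w k c \<notin> F" "pt w (k - 1) c \<notin> F"
  shows "pt w k (c + 1) \<in> T \<longleftrightarrow> pt w k c \<in> T"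
  using d_advance[of k c] assms by (auto simp: T_def type_points_def)

lemma T_square:
  assumes "pt w r c \<in> F"
  shows "pt w (r + t) c \<in> T" "pt w (r + 1 - t) (c + 1) \<in> T"
    "pt w (r + 1 - t) c \<notin> T" "pt w (r + t) (c + 1) \<notin> T"
  using d_square[OF assms] assms F_filled filled_bounds[of r c] t
  by (auto simp: T_def type_points_def)

section \<open>Segments and diagonal lines\<close>

lemma segment_subset: "S \<in> segments w T \<Longrightarrow> S \<subseteq> T"
  unfolding segments_def by (rule components_subset)

lemma segment_advance:
  assumes "S \<in> segments w T" "pt w k c \<in> T" "pt w k (c + 1) \<in> T"
  shows "pt w k c \<in> S \<longleftrightarrow> pt w k (c + 1) \<in> S"
proof -
  have "{pt w k c, pt w k (c + 1)} \<in> unit_lines w T"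
    using assms unfolding unit_lines_def by (intro CollectI exI[of _ "pt w k c"]) simp
  then show ?thesis
    using assms components_closed[of S T "unit_lines w T"]
    unfolding segments_def by (metis insert_commute)
qed

lemma segment_line:
  assumes "S \<in> segments w T" "P \<in> S" "Q \<in> S"
  shows "line w P = line w Q"
proof (rule components_invariant[OF assms[unfolded segments_def]])
  fix P Q assume "{P, Q} \<in> unit_lines w T"
  then obtain X where "{P, Q} = {X, advance w X}" unfolding unit_lines_def by blast
  moreover have "line w (advance w X) = line w X"
    by (cases rule: pt_exhaust[of X w]) simp
  ultimately show "line w P = line w Q" by (auto simp: doubleton_eq_iff)
qed

text \<open>Beside a filled square outside \<open>F\<close> the type does not change along either
  side in the direction of travel, so a segment contains both ends of such a side or neither, never
  a single corner.\<close>

lemma diagonal_at_filled: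
  assumes S: "S \<in> segments w T" "touches_at S (pt w r c) P"
    and filled_rc: "pt w r c \<in> filled_squares n \<pi>"
  shows "pt w r c \<in> F"
proof (rule ccontr)
  assume rc: "pt w r c \<notin> F"
  have c: "c \<in> {1..n}" using filled_bounds filled_rc by blast
  \<comment> \<open>This is the only filled square at level \<open>c\<close>, so \<open>F\<close>
    has none there.\<close>
  have no: "pt w k c \<notin> F" for k
    using rc filled_col[OF filled_rc, of k] subsetD[OF F_filled, of "pt w k c"] by metis
  have same: "pt w k c \<in> S \<longleftrightarrow> pt w k (c + 1) \<in> S" for k
    using T_advance[OF c no no, of k] segment_advance[OF S(1), of k c] segment_subset[OF S(1)]
    by blast
  have P: "P \<in> S" "P \<in> corners (pt w r c)"
    and only: "\<And>Q. Q \<in> S \<Longrightarrow> Q \<in> corners (pt w r c) \<Longrightarrow> Q = P"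
    using S(2) unfolding touches_at_def by auto
  from P(2) obtain k where k: "k \<in> {r, r + 1}" "P = pt w k c \<or> P = pt w k (c + 1)"
    by (auto simp: corners_pt)
  then have "pt w k c = P" "pt w k (c + 1) = P"
    using same[of k] P(1) by (auto intro!: only simp: corners_pt)
  then show False by (metis pt_eq_iff n_not_Suc_n Suc_eq_plus1)
qed

text \<open>The two corners of type \<open>t\<close> are opposite, hence on different lines, and a
  segment stays on one line: it meets the square in one corner only.\<close>

lemma touching_segment:
  assumes rc: "pt w r c \<in> F" and "P = pt w (r + t) c \<or> P = pt w (r + 1 - t) (c + 1)"
  obtains S where "S \<in> segments w T" "\<not> spans_line n w S" "touches_at S (pt w r c) P"
proof -
  note sq = T_square[OF rc]
  have c: "c \<in> {1..n}" using filled_bounds F_filled rc by blast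
  have PT: "P \<in> T" using assms(2) sq by auto
  then obtain S where S: "S \<in> segments w T" "P \<in> S"
    unfolding segments_def by (rule ex_component)
  have "S \<inter> corners (pt w r c) \<subseteq> {P}"
  proof
    fix Q assume Q: "Q \<in> S \<inter> corners (pt w r c)"
    then have "Q \<in> T" using segment_subset[OF S(1)] by auto
    then have "Q = pt w (r + t) c \<or> Q = pt w (r + 1 - t) (c + 1)"
      using Q sq t by (auto simp: corners_pt)
    moreover have "line w Q = line w P" using segment_line[OF S(1)] Q S(2) by blast
    ultimately show "Q \<in> {P}" using assms(2) t by auto
  qed
  moreover have "P \<in> corners (pt w r c)" using assms(2) t by (auto simp: corners_pt)
  ultimately have touch: "touches_at S (pt w r c) P"
    using S(2) unfolding touches_at_def by auto
  \<comment> \<open>Both lines along the square have a corner of the other type, so neither lies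
    wholly in \<open>T\<close>.\<close>
  have "\<not> spans_line n w S"
  proof
    assume "spans_line n w S"
    then obtain l where l: "S = grid_line n w l" unfolding spans_line_def by blast
    then have "{pt w l c, pt w l (c + 1)} \<subseteq> T"
      using c segment_subset[OF S(1)] by auto
    moreover have "l = r + t \<or> l = r + 1 - t" using S(2) l assms(2) by auto
    ultimately show False using sq by auto
  qed
  with S touch show thesis by (intro that)
qed

text \<open>Touching restricts the squares to \<open>F\<close>; of the two diagonals of such a
  square only one has its ends in \<open>T\<close>, and \<open>t\<close> determines which.\<close>

lemma diagonal_lines_eq:
  "diagonal_lines w n \<pi> T =
    {{P, Q} | P Q. \<exists>s \<in> F. (P, Q) = crossing (heading_of w t) s}" (is "?L = ?R")
proof (intro equalityI subsetI)
  fix e assume "e \<in> ?L"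
  then obtain P Q s S S' where e: "e = {P, Q}" and s: "s \<in> filled_squares n \<pi>"
    and S: "S \<in> segments w T" "S' \<in> segments w T"
    and touch: "touches_at S s P" "touches_at S' s Q" and diag: "{P, Q} \<in> diagonals s"
    unfolding diagonal_lines_def by blast
  obtain r c where rc: "s = pt w r c" by (rule pt_exhaust)
  have sF: "s \<in> F" using diagonal_at_filled S touch s unfolding rc by blast
  have sub: "e \<subseteq> T"
    using touch segment_subset[OF S(1)] segment_subset[OF S(2)] unfolding touches_at_def e by blast
  have diag_e: "e \<in> {{pt w r c, pt w (r + 1) (c + 1)}, {pt w (r + 1) c, pt w r (c + 1)}}"
    using diag unfolding rc diagonals_pt e .
  from t consider "t = 0" | "t = 1" by blast
  then have "e = {pt w (r + t) c, pt w (r + 1 - t) (c + 1)}"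
  proof cases
    case 1
    then have "pt w (r + 1) c \<notin> T" using T_square(3)[OF sF[unfolded rc]] by simp
    then have "e = {pt w r c, pt w (r + 1) (c + 1)}" using sub diag_e by blast
    then show ?thesis by (simp add: 1)
  next
    case 2
    then have "pt w r c \<notin> T" using T_square(3)[OF sF[unfolded rc]] by simp
    then have "e = {pt w (r + 1) c, pt w r (c + 1)}" using sub diag_e by blast
    then show ?thesis by (simp add: 2)
  qed
  moreover have "(pt w (r + t) c, pt w (r + 1 - t) (c + 1)) = crossing (heading_of w t) s"
    by (simp add: rc crossing_pt[OF t])
  ultimately show "e \<in> ?R" using sF by (intro CollectI exI conjI bexI)
next
  fix e assume "e \<in> ?R"
  then obtain P Q s where e: "e = {P, Q}" and sF: "s \<in> F"
    and PQ: "(P, Q) = crossing (heading_of w t) s" by blast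
  obtain r c where rc: "s = pt w r c" by (rule pt_exhaust)
  have P: "P = pt w (r + t) c" and Q: "Q = pt w (r + 1 - t) (c + 1)"
    using PQ crossing_pt[OF t] unfolding rc by auto
  obtain S where S: "S \<in> segments w T" "\<not> spans_line n w S" "touches_at S s P"
    using touching_segment[of r c P] sF P unfolding rc by blast
  obtain S' where S': "S' \<in> segments w T" "\<not> spans_line n w S'" "touches_at S' s Q"
    using touching_segment[of r c Q] sF Q unfolding rc by blast
  have "{P, Q} \<in> diagonals s" using t unfolding P Q rc diagonals_pt by auto
  moreover have "s \<in> filled_squares n \<pi>" using sF F_filled by blast
  ultimately show "e \<in> ?L"
    unfolding diagonal_lines_def e using S S'
    by (intro CollectI exI[of _ P] exI[of _ Q] conjI[OF refl]) blast
qed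

section \<open>The edges directed along the travel\<close>

definition course :: "point \<Rightarrow> point \<Rightarrow> bool" where
  "course P Q \<longleftrightarrow> P \<in> T \<and> Q \<in> T \<and> Q = advance w P \<or>
     (\<exists>s \<in> F. (P, Q) = crossing (heading_of w t) s)"

lemma course_pt:
  "course (pt w k c) (pt w k' c') \<longleftrightarrow> c' = c + 1 \<and>
    (k' = k \<and> pt w k c \<in> T \<and> pt w k (c + 1) \<in> T \<or>
     (\<exists>r. pt w r c \<in> F \<and> k = r + t \<and> k' = r + 1 - t))"
proof -
  have "(\<exists>s \<in> F. (pt w k c, pt w k' c') = crossing (heading_of w t) s) \<longleftrightarrow>
      (\<exists>r. pt w r c \<in> F \<and> k = r + t \<and> k' = r + 1 - t \<and> c' = c + 1)" (is "?L \<longleftrightarrow> ?R")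
  proof
    assume ?L
    then obtain s where s: "s \<in> F" "(pt w k c, pt w k' c') = crossing (heading_of w t) s" by blast
    obtain r b where "s = pt w r b" by (rule pt_exhaust)
    with s show ?R by (simp add: crossing_pt[OF t])
  next
    assume ?R
    then obtain r where r: "pt w r c \<in> F" and "k = r + t" "k' = r + 1 - t" "c' = c + 1" by blast
    then have "(pt w k c, pt w k' c') = crossing (heading_of w t) (pt w r c)"
      by (simp add: crossing_pt[OF t])
    with r show ?L by (rule bexI[rotated])
  qed
  then show ?thesis unfolding course_def by auto
qed

lemma edges_eq: "unit_lines w T \<union> diagonal_lines w n \<pi> T = {{P, Q} | P Q. course P Q}"
proof -
  have "unit_lines w T = {{P, Q} | P Q. P \<in> T \<and> Q \<in> T \<and> Q = advance w P}"
    unfolding unit_lines_def by (simp del: split_paired_Ex)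
  then show ?thesis
    unfolding diagonal_lines_eq course_def
    by (simp only: Un_def mem_Collect_eq conj_disj_distribL ex_disj_distrib)
qed

text \<open>As \<open>t\<close> is 0 or 1, \<open>r + t\<close> and \<open>r + 1 - t\<close> are
  \<open>r\<close> and \<open>r + 1\<close> in some order; a crossing starts on the first of these
  lines.\<close>

lemma F_adjacent:
  "pt w k c \<in> F \<or> pt w (k - 1) c \<in> F \<Longrightarrow> \<exists>r. pt w r c \<in> F \<and> (k = r + t \<or> k = r + 1 - t)"
  using t F[of "k - 1" c] by (cases "k = 0") auto

text \<open>Next to a square of \<open>F\<close>, a point of type \<open>t\<close> must be the
  corner where the crossing starts, since the other near corner has the other type. Elsewhere the
  type persists along the line.\<close>

lemma course_succ:
  assumes "pt w k c \<in> T" "c \<le> n"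
  shows "\<exists>k'. course (pt w k c) (pt w k' (c + 1))"
proof (cases "pt w k c \<in> F \<or> pt w (k - 1) c \<in> F")
  case True
  then show ?thesis using F_adjacent[OF True] T_square(3) assms by (auto simp: course_pt)
next
  case False
  then show ?thesis using T_advance[of c k] T_bounds[OF assms(1)] assms by (auto simp: course_pt)
qed

text \<open>The mirror image: of the two far corners of a square only the end of the crossing has
  type \<open>t\<close>.\<close>

lemma course_pred:
  assumes "pt w k (c + 1) \<in> T" "1 \<le> c"
  shows "\<exists>k'. course (pt w k' c) (pt w k (c + 1))"
proof (cases "pt w k c \<in> F \<or> pt w (k - 1) c \<in> F")
  case True
  then show ?thesis using F_adjacent[OF True] T_square(4) assms by (auto simp: course_pt)
next
  case False
  then show ?thesis using T_advance[of c k] T_bounds[OF assms(1)] assms by (auto simp: course_pt)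
qed

lemma course_T:
  assumes "course P Q"
  shows "P \<in> T \<and> Q \<in> T \<and> lev w Q = lev w P + 1"
proof -
  obtain k c k' c' where "P = pt w k c" "Q = pt w k' c'" by (metis pt_exhaust)
  then show ?thesis using assms T_square by (auto simp: course_pt)
qed

text \<open>Where a crossing starts, the next point on the same line has the other type; two
  crossings from one point coincide because each level has at most one square of
  \<open>F\<close>.\<close>

lemma course_runique:
  assumes "course P Q" "course P Q'"
  shows "Q = Q'"
proof -
  obtain k c k1 c1 k2 c2 where "P = pt w k c" "Q = pt w k1 c1" "Q' = pt w k2 c2"
    by (metis pt_exhaust)
  then show ?thesis
    using assms T_square(4) by (simp add: course_pt) (metis F_col)
qed

text \<open>Where a crossing ends, the preceding point on the same line has the other type.\<close>

lemma course_lunique: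
  assumes "course P Q" "course P' Q"
  shows "P = P'"
proof -
  obtain k c k1 c1 k2 c2 where "Q = pt w k c" "P = pt w k1 c1" "P' = pt w k2 c2"
    by (metis pt_exhaust)
  then show ?thesis
    using assms T_square(3) by (simp add: course_pt) (metis F_col)
qed

text \<open>A side of a square of \<open>F\<close> changes type, so the course cannot run along it
  and has to cross. Conversely, every crossing starts at a near corner.\<close>

lemma course_step:
  assumes "course P Q"
  shows "step w F (heading_of w t) P Q"
proof -
  obtain k c where P: "P = pt w k c" by (rule pt_exhaust)
  have near: "(\<exists>s \<in> F. P \<in> near_corners w s) \<longleftrightarrow> (\<exists>r. pt w r c \<in> F \<and> (k = r \<or> k = r + 1))"
  proof
    assume "\<exists>s \<in> F. P \<in> near_corners w s"
    then obtain s where s: "s \<in> F" "P \<in> near_corners w s" by blast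
    obtain r b where "s = pt w r b" by (rule pt_exhaust)
    with s show "\<exists>r. pt w r c \<in> F \<and> (k = r \<or> k = r + 1)"
      unfolding P by (auto simp: near_corners_pt)
  next
    assume "\<exists>r. pt w r c \<in> F \<and> (k = r \<or> k = r + 1)"
    then obtain r where r: "pt w r c \<in> F" "k = r \<or> k = r + 1" by blast
    then have "P \<in> near_corners w (pt w r c)" unfolding P by (auto simp: near_corners_pt)
    with r(1) show "\<exists>s \<in> F. P \<in> near_corners w s" by (rule bexI[rotated])
  qed
  show ?thesis
  proof (cases "\<exists>s \<in> F. P \<in> near_corners w s")
    case True
    then obtain r where r: "pt w r c \<in> F" "k = r \<or> k = r + 1" using near by blast
    then have "\<not> (P \<in> T \<and> advance w P \<in> T)"
      using T_square[OF r(1)] t unfolding P by auto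
    then show ?thesis using assms True unfolding course_def step_def by auto
  next
    case False
    have "Q = advance w P"
    proof (rule ccontr)
      assume "Q \<noteq> advance w P"
      then obtain s where s: "s \<in> F" "(P, Q) = crossing (heading_of w t) s"
        using assms unfolding course_def by auto
      obtain r c' where "s = pt w r c'" by (rule pt_exhaust)
      with s False show False using t crossing_pt[OF t] by (auto simp: near_corners_pt)
    qed
    then show ?thesis using False unfolding step_def by auto
  qed
qed

theorem paths_traverse:
  assumes "\<gamma> \<in> paths w n \<pi> d (int t)"
  shows "traverses w n F (heading_of w t) \<gamma>"
proof -
  let ?E = "{{P, Q} | P Q. course P Q}"
  obtain C where C: "C \<in> components T ?E" and \<gamma>: "\<gamma> = (C, {e \<in> ?E. e \<subseteq> C})"
    using assms unfolding paths_def Let_def T_def[symmetric] edges_eq by blast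
  have bounds: "1 \<le> lev w P \<and> lev w P \<le> n + 1" if "P \<in> T" for P
    using that T_bounds by (cases rule: pt_exhaust[of P w]) auto
  have succ: "\<exists>Q. course P Q" if "P \<in> T" "lev w P < n + 1" for P
    using that course_succ by (cases rule: pt_exhaust[of P w]) fastforce
  have pred: "\<exists>P. course P Q" if "Q \<in> T" "1 < lev w Q" for Q
  proof -
    obtain k c where Q: "Q = pt w k c" by (rule pt_exhaust)
    have "1 < c" using that(2) by (simp add: Q)
    then have "\<exists>k'. course (pt w k' (c - 1)) (pt w k c)"
      using course_pred[of k "c - 1"] that(1) by (simp add: Q)
    then show ?thesis unfolding Q by blast
  qed
  \<comment> \<open>The levels are the \<open>n + 1\<close> positions along the direction of travel,
    so the walk runs from side to side.\<close>
  obtain vs where vs: "vs \<noteq> []" "set vs = C" "lev w (hd vs) = 1" "lev w (last vs) = n + 1"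
    "\<forall>k. k + 1 < length vs \<longrightarrow> course (vs ! k) (vs ! (k + 1))"
    "{e \<in> ?E. e \<subseteq> C} = {{vs ! k, vs ! (k + 1)} | k. k + 1 < length vs}"
    by (rule component_walk[OF C, of "lev w" "n + 1"],
        erule bounds, erule course_T, erule (1) succ, erule (1) pred,
        erule (1) course_runique, erule (1) course_lunique)
  have "hd vs \<in> T" "last vs \<in> T" using vs(1,2) components_subset[OF C] by auto
  have "hd vs \<in> first_side n w"
    using \<open>hd vs \<in> T\<close> vs(3) T_bounds by (cases rule: pt_exhaust[of "hd vs" w]) auto
  moreover have "last vs \<in> last_side n w"
    using \<open>last vs \<in> T\<close> vs(4) T_bounds by (cases rule: pt_exhaust[of "last vs" w]) auto
  moreover have "\<forall>k. k + 1 < length vs \<longrightarrow> step w F (heading_of w t) (vs ! k) (vs ! (k + 1))"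
    using vs(5) by (intro allI impI course_step) simp
  moreover have "\<gamma> = (set vs, {{vs ! k, vs ! (k + 1)} | k. k + 1 < length vs})"
    unfolding \<gamma> vs(6) vs(2) ..
  ultimately show ?thesis
    unfolding traverses_def using vs(1) by (intro exI[of _ vs] conjI)
qed

end

end

section \<open>Horizontal and vertical instances\<close>

lemma filled_squares_iff:
  assumes "\<pi> \<in> signed_perms n"
  shows "(i, j) \<in> filled_squares n \<pi> \<longleftrightarrow> i \<in> {1..n} \<and> \<bar>\<pi> i\<bar> = int j"
proof -
  have "\<pi> i < 0 \<or> 0 < \<pi> i" if "i \<in> {1..n}"
    using signed_perms_nonzero[OF assms that] by auto
  then show ?thesis
    by (auto simp: filled_squares_def positive_squares_def negative_squares_def)
qed

lemma positive_squares_iff: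
  "(i, j) \<in> positive_squares n \<pi> \<longleftrightarrow> i \<in> {1..n} \<and> 1 \<le> j \<and> \<pi> i = int j"
  by (auto simp: positive_squares_def)

lemma negative_squares_iff:
  "(i, j) \<in> negative_squares n \<pi> \<longleftrightarrow> i \<in> {1..n} \<and> 1 \<le> j \<and> \<pi> i = - int j"
  by (auto simp: negative_squares_def)

lemma horizontal_typed_grid:
  assumes "\<pi> \<in> signed_perms n"
  shows "typed_grid Horizontal n \<pi> \<pi> 1 (positive_squares n \<pi>) (\<lambda>P. fst (d_plus n \<pi> P))"
    and "typed_grid Horizontal n \<pi> \<pi> (- 1) (negative_squares n \<pi>) (\<lambda>P. fst (d_minus n \<pi> P))"
proof -
  note squares = filled_squares_iff[OF assms] positive_squares_iff negative_squares_iff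
  have plus: "fst (d_plus n \<pi> (pt Horizontal k c)) = jump n (1 * int c) \<pi> k"
    and minus: "fst (d_minus n \<pi> (pt Horizontal k c)) = jump n (- 1 * int c) \<pi> k"
    if "k \<in> {1..n + 1}" "c \<in> {1..n + 1}" for k c
    using that des_B_insert_entry[of c 1 k n \<pi>] des_B_insert_entry[of c "- 1" k n \<pi>]
    by (simp_all add: d_plus_def d_minus_def)
  show "typed_grid Horizontal n \<pi> \<pi> 1 (positive_squares n \<pi>) (\<lambda>P. fst (d_plus n \<pi> P))"
    by (rule typed_grid.intro[OF assms _ _ _ plus]) (simp_all add: squares)
  show "typed_grid Horizontal n \<pi> \<pi> (- 1) (negative_squares n \<pi>) (\<lambda>P. fst (d_minus n \<pi> P))"
    by (rule typed_grid.intro[OF assms _ _ _ minus]) (simp_all add: squares)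
qed

text \<open>\<open>pt Vertical r c\<close> is \<open>(c, r)\<close>, so the index across the travel
  is a column, that is, a position in the inverse.\<close>

lemma vertical_typed_grid:
  assumes \<pi>: "\<pi> \<in> signed_perms n"
  shows "typed_grid Vertical n \<pi> (signed_inv n \<pi>) 1 (positive_squares n \<pi>)
      (\<lambda>P. snd (d_plus n \<pi> P))"
    and "typed_grid Vertical n \<pi> (signed_inv n \<pi>) (- 1) (negative_squares n \<pi>)
      (\<lambda>P. snd (d_minus n \<pi> P))"
proof -
  let ?\<rho> = "signed_inv n \<pi>"
  have \<rho>: "?\<rho> \<in> signed_perms n" by (rule signed_inv_in_signed_perms[OF \<pi>])
  have iff: "i \<in> {1..n} \<and> 1 \<le> j \<and> \<pi> i = \<epsilon> * int j \<longleftrightarrow> j \<in> {1..n} \<and> 1 \<le> i \<and> ?\<rho> j = \<epsilon> * int i"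
    if "\<epsilon> \<in> {1, - 1}" for i j \<epsilon>
  proof -
    have abs: "nat \<bar>\<epsilon> * int m\<bar> = m" for m using that by (auto simp: abs_mult)
    have "j \<in> {1..n}" if "i \<in> {1..n}" "\<pi> i = \<epsilon> * int j"
      using signed_perms_nonzero[OF \<pi> that(1)] unfolding that(2) abs .
    moreover have "i \<in> {1..n}" if "j \<in> {1..n}" "?\<rho> j = \<epsilon> * int i"
      using signed_perms_nonzero[OF \<rho> that(1)] unfolding that(2) abs .
    moreover have "?\<rho> j = \<epsilon> * int i \<longleftrightarrow> \<pi> i = \<epsilon> * int j" if "1 \<le> i" "1 \<le> j"
      using signed_inv_eq_iff[OF \<pi> \<open>\<epsilon> \<in> _\<close> that] .
    ultimately show ?thesis by (metis atLeastAtMost_iff)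
  qed
  have pos: "(c, r) \<in> positive_squares n \<pi> \<longleftrightarrow> r \<in> {1..n} \<and> 1 \<le> c \<and> ?\<rho> r = 1 * int c" for r c
    using iff[of 1 c r] unfolding positive_squares_iff by simp
  have neg: "(c, r) \<in> negative_squares n \<pi> \<longleftrightarrow> r \<in> {1..n} \<and> 1 \<le> c \<and> ?\<rho> r = - 1 * int c" for r c
    using iff[of "- 1" c r] unfolding negative_squares_iff by simp
  have fil: "(c, r) \<in> filled_squares n \<pi> \<longleftrightarrow> r \<in> {1..n} \<and> \<bar>?\<rho> r\<bar> = int c" for r c
  proof -
    have "1 \<le> c \<and> (?\<rho> r = int c \<or> ?\<rho> r = - int c) \<longleftrightarrow> \<bar>?\<rho> r\<bar> = int c" if "r \<in> {1..n}"
      using signed_perms_nonzero[OF \<rho> that] by auto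
    then show ?thesis using pos[of c r] neg[of c r] unfolding filled_squares_def by auto
  qed
  \<comment> \<open>Inserting in row \<open>c\<close> and column \<open>k\<close> inserts
    \<open>\<epsilon> * int c\<close> at position \<open>k\<close> of the inverse, where the descent
    formula applies.\<close>
  have d: "int (ides_B (n + 1) (insert_entry c k (\<epsilon> * int k) \<pi>)) - int (ides_B n \<pi>) =
      jump n (\<epsilon> * int c) ?\<rho> k"
    if "k \<in> {1..n + 1}" "c \<in> {1..n + 1}" "\<epsilon> \<in> {1, - 1}" for \<epsilon> k c
    using that des_B_insert_entry[of c \<epsilon> k n ?\<rho>]
    unfolding ides_B_def signed_inv_insert_entry[OF \<pi> that(2,1,3)] by simp
  have plus: "snd (d_plus n \<pi> (pt Vertical k c)) = jump n (1 * int c) ?\<rho> k"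
    and minus: "snd (d_minus n \<pi> (pt Vertical k c)) = jump n (- 1 * int c) ?\<rho> k"
    if "k \<in> {1..n + 1}" "c \<in> {1..n + 1}" for k c
    using d[OF that, of 1] d[OF that, of "- 1"] by (simp_all add: d_plus_def d_minus_def)
  show "typed_grid Vertical n \<pi> ?\<rho> 1 (positive_squares n \<pi>) (\<lambda>P. snd (d_plus n \<pi> P))"
    by (rule typed_grid.intro[OF \<rho> _ _ _ plus]) (simp_all add: fil pos)
  show "typed_grid Vertical n \<pi> ?\<rho> (- 1) (negative_squares n \<pi>) (\<lambda>P. snd (d_minus n \<pi> P))"
    by (rule typed_grid.intro[OF \<rho> _ _ _ minus]) (simp_all add: fil neg)
qed

theorem theorem6p6:
  fixes n :: nat and \<pi> :: "nat \<Rightarrow> int"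
  assumes "\<pi> \<in> signed_perms n"
  shows
    "((\<forall>\<gamma> \<in> h_plus_paths n \<pi> 0. traverses Horizontal n (positive_squares n \<pi>) Southeast \<gamma>) \<and>
      (\<forall>\<gamma> \<in> h_plus_paths n \<pi> 1. traverses Horizontal n (positive_squares n \<pi>) Northeast \<gamma>)) \<and>
     ((\<forall>\<gamma> \<in> v_plus_paths n \<pi> 0. traverses Vertical n (positive_squares n \<pi>) Southeast \<gamma>) \<and>
      (\<forall>\<gamma> \<in> v_plus_paths n \<pi> 1. traverses Vertical n (positive_squares n \<pi>) Southwest \<gamma>)) \<and>
     ((\<forall>\<gamma> \<in> h_minus_paths n \<pi> 0. traverses Horizontal n (negative_squares n \<pi>) Southeast \<gamma>) \<and>
      (\<forall>\<gamma> \<in> h_minus_paths n \<pi> 1. traverses Horizontal n (negative_squares n \<pi>) Northeast \<gamma>)) \<and>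
     ((\<forall>\<gamma> \<in> v_minus_paths n \<pi> 0. traverses Vertical n (negative_squares n \<pi>) Southeast \<gamma>) \<and>
      (\<forall>\<gamma> \<in> v_minus_paths n \<pi> 1. traverses Vertical n (negative_squares n \<pi>) Southwest \<gamma>))"
proof -
  note hp = typed_grid.paths_traverse[OF horizontal_typed_grid(1)[OF assms]]
  note hm = typed_grid.paths_traverse[OF horizontal_typed_grid(2)[OF assms]]
  note vp = typed_grid.paths_traverse[OF vertical_typed_grid(1)[OF assms]]
  note vm = typed_grid.paths_traverse[OF vertical_typed_grid(2)[OF assms]]
  show ?thesis
    \<comment> \<open>With \<open>t\<close> equal to 0 or 1, \<open>heading_of\<close> evaluates to
      the claimed headings.\<close>
    using hp[of 0] hp[of 1] hm[of 0] hm[of 1] vp[of 0] vp[of 1] vm[of 0] vm[of 1] by simp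
qed

end
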